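(* Let $p\in\{2,3\}$ and let $T\in\mathcal T_h^i$ be any interface element. Then the IFE basis functions $\phi^p_{i,T}$, $i\in\mathcal I_p$, satisfy $$\sum_{i\in\mathcal I_p}\phi^p_{i,T}\equiv 1\quad\text{on }T.$$
   Context: Setting. $\Omega\subset\mathbb R^2$ is a bounded open polygonal domain, separated by a closed, regular, simple $C^2$ interface curve $\Gamma$ into two subdomains $\Omega^+,\Omega^-$, with $\overline\Omega=\overline{\Omega^+\cup\Omega^-\cup\Gamma}$. $\beta$ is piecewise constant, $\beta=\beta^\pm>0$ on $\Omega^\pm$. $\mathcal T_h$ is a shape-regular triangular mesh of $\Omega$ with mesh size $h=\max_T h_T$, $h_T=\operatorname{diam}T$. Assumptions: for every edge $e$, $\Gamma\cap e$ is at most one isolated point unless $e\subset\Gamma$; for every element $K$, $\Gamma$ meets $\partial K$ on at most two distinct edges of $K$ (vertex intersections are allowed; if $\Gamma$ meets $\partial K$ at two vertices these are regarded as lying on two distinct edges); and $h<r/2$, where $r>0$ is such that the segments $N_X(r)$ of length $2r$ centered at $X\in\Gamma$ and perpendicular to $\Gamma$ are pairwise disjoint for distinct $X\in\Gamma$. The interface elements are $\mathcal T_h^i=\{T\in\mathcal T_h: T\cap\Gamma\ne\emptyset\}$; for such $T$, $T^\pm=T\cap\Omega^\pm$. Local spaces. $\mathcal P_p(T)$ is the space of polynomials of degree at most $p$; $\{A_i\}_{i\in\mathcal I_p}$ are the standard degree-$p$ Lagrange nodes of $T$, $|\mathcal I_p|=(p+1)(p+2)/2$, and $\psi^p_{i,T}\in\mathcal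 P_p(T)$ are the Lagrange shape functions, $\psi^p_{i,T}(A_j)=\delta_{ij}$. $\mathcal I_p^\pm=\{i\in\mathcal I_p:A_i\in T^\pm\}$ (a node lying on $\Gamma$ is assigned to exactly one of the two sets, so $\mathcal I_p=\mathcal I_p^+\sqcup\mathcal I_p^-$). $\mathcal S_p(T)=\mathcal P_p(T)\times\mathcal P_p(T)$, and $\mathcal M_T$ maps $(u_1,u_2)\in\mathcal S_p(T)$ to the piecewise polynomial equal to $u_1$ on $T^+$ and $u_2$ on $T^-$. A basis of $\mathcal S_p(T)$ is: $\xi^p_{i,T}=(\psi^p_{i,T},0)$, $\eta^p_{i,T}=(0,\psi^p_{i,T})$ if $i\in\mathcal I_p^+$; $\xi^p_{i,T}=(0,\psi^p_{i,T})$, $\eta^p_{i,T}=(\psi^p_{i,T},0)$ if $i\in\mathcal I_p^-$. Bilinear form. For a factor $\lambda>1$, the fictitious element is $T_\lambda=\{X\in\mathbb R^2:\exists\,Y\in T,\ \overrightarrow{OX}=\lambda\overrightarrow{OY}\}$, $O$ the barycenter of $T$, and $\Gamma_T^\lambda=T_\lambda\cap\Gamma$. For $u=(u_1,u_2)\in\mathcal S_p(T)$ the polynomials $u_1,u_2$ are extended to $\mathbb R^2$, and on $\Gamma_T^\lambda$, for a differential operator $D$, $[\![Du]\!]=Du_1-Du_2$ and $[\![\beta Du]\!]=\beta^+Du_1-\beta^-Du_2$. With $n,t$ the unit normal and tangent to $\Gamma$, $\partial_nv=\sum_i n_i\partial_iv$, $\partial_{nn}v=\sum_{i,j}n_in_j\partial_{ij}v$,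 $\partial_{ntt}v=\sum_{i,j,k}n_it_jt_k\partial_{ijk}v$. For fixed weights $\omega_0,\dots,\omega_3>0$, $$\mathcal J^p_\lambda(u,v)=\omega_0\int_{\Gamma_T^\lambda}[\![u]\!][\![v]\!]ds+\omega_1h^2\int_{\Gamma_T^\lambda}[\![\partial_nu]\!][\![\partial_nv]\!]ds+\omega_2h^4\int_{\Gamma_T^\lambda}[\![\beta\partial_{nn}u]\!][\![\beta\partial_{nn}v]\!]ds$$ $$+\,\omega_3h^6\int_{\Gamma_T^\lambda}[\![\beta(\partial_n\Delta u+\partial_{ntt}u)]\!][\![\beta(\partial_n\Delta v+\partial_{ntt}v)]\!]ds.$$ IFE basis functions. For $p\in\{2,3\}$ and each nodal value vector $\mathbf v\in\mathbb R^{|\mathcal I_p|}$ there is a unique $\varphi^p_T|_{\mathbf v}=\sum_{i}v_i\xi^p_{i,T}+\sum_ic_i\eta^p_{i,T}$ with $\mathcal J^p_\lambda(\varphi^p_T|_{\mathbf v},\eta^p_{i,T})=0$ for all $i\in\mathcal I_p$ (unisolvence, which may be assumed known). The IFE basis functions are $\phi^p_{i,T}=\mathcal M_T(\varphi^p_T|_{\mathbf e_i})$, with $\mathbf e_i$ the canonical basis vectors of $\mathbb R^{|\mathcal I_p|}$. *)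

theory Defs
  imports "HOL-Analysis.Analysis"
begin

type_synonym plane = "real ^ 2"

section \<open>Domain, interface and mesh\<close>

definition polygonal_domain :: "plane set \<Rightarrow> bool" where
  "polygonal_domain \<Omega> \<longleftrightarrow> \<Omega> \<noteq> {} \<and> open \<Omega> \<and> connected \<Omega> \<and> bounded \<Omega> \<and>
     (\<exists>E. finite E \<and> frontier \<Omega> = (\<Union>(a, b)\<in>E. closed_segment a b))"

text \<open>The interface is the trace \<open>path_image \<gamma>\<close> of a 1-periodic parametrization \<open>\<gamma>\<close>;
  periodicity makes the curve closed and \<open>C\<^sup>2\<close> also at the base point.\<close>

definition regular_simple_closed_C2 :: "(real \<Rightarrow> plane) \<Rightarrow> bool" where
  "regular_simple_closed_C2 \<gamma> \<longleftrightarrow>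
     (\<forall>s. \<gamma> (s + 1) = \<gamma> s) \<and> simple_path \<gamma> \<and>
     (\<exists>\<gamma>1 \<gamma>2. (\<forall>s. (\<gamma> has_vector_derivative \<gamma>1 s) (at s)) \<and>
             (\<forall>s. (\<gamma>1 has_vector_derivative \<gamma>2 s) (at s)) \<and>
             continuous_on UNIV \<gamma>2 \<and> (\<forall>s. \<gamma>1 s \<noteq> 0))"

definition tangent :: "(real \<Rightarrow> plane) \<Rightarrow> real \<Rightarrow> plane" where
  "tangent \<gamma> s = sgn (vector_derivative \<gamma> (at s))"

text \<open>The sign of the normal is immaterial: in every term of the bilinear form below the
  normal enters both factors with the same parity.\<close>

definition normal :: "(real \<Rightarrow> plane) \<Rightarrow> real \<Rightarrow> plane" where
  "normal \<gamma> s = vector [tangent \<gamma> s $ 2, - tangent \<gamma> s $ 1]"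

definition separates_into :: "plane set \<Rightarrow> plane set \<Rightarrow> plane set \<Rightarrow> plane set \<Rightarrow> bool" where
  "separates_into \<Gamma> \<Omega> \<Omega>p \<Omega>m \<longleftrightarrow>
     \<Omega> - \<Gamma> = \<Omega>p \<union> \<Omega>m \<and> \<Omega>p \<inter> \<Omega>m = {} \<and> closure \<Omega> = closure (\<Omega>p \<union> \<Omega>m \<union> \<Gamma>) \<and>
     open \<Omega>p \<and> connected \<Omega>p \<and> \<Omega>p \<noteq> {} \<and> open \<Omega>m \<and> connected \<Omega>m \<and> \<Omega>m \<noteq> {}"

definition triangular_mesh :: "plane set \<Rightarrow> plane set set \<Rightarrow> bool" where
  "triangular_mesh \<Omega> \<T> \<longleftrightarrow> triangulation \<T> \<and> (\<forall>T\<in>\<T>. 2 simplex T) \<and> \<Union>\<T> = closure \<Omega>"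

definition mesh_size :: "plane set set \<Rightarrow> real" where
  "mesh_size \<T> = Max (diameter ` \<T>)"

definition shape_regular :: "real \<Rightarrow> plane set set \<Rightarrow> bool" where
  "shape_regular \<sigma> \<T> \<longleftrightarrow> (\<forall>T\<in>\<T>. diameter T \<le> \<sigma> * (SUP r \<in> {r. \<exists>x. cball x r \<subseteq> T}. 2 * r))"

text \<open>The last alternative is the case of two vertex intersections: the two endpoints of \<open>e\<close>
  then count as intersections with two distinct edges, not as two points of \<open>e\<close>.\<close>

definition edge_condition :: "plane set \<Rightarrow> plane set set \<Rightarrow> bool" where
  "edge_condition \<Gamma> \<T> \<longleftrightarrow> (\<forall>K\<in>\<T>. \<forall>e. e edge_of K \<longrightarrow>
     e \<subseteq> \<Gamma> \<or> (\<exists>x. \<Gamma> \<inter> e \<subseteq> {x}) \<or> \<Gamma> \<inter> e = {x. x extreme_point_of e})"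

text \<open>\<open>X1\<close> and \<open>X2\<close> are the parts of \<open>\<Gamma> \<inter> \<partial>K\<close> attributed to the edges \<open>e1\<close> and \<open>e2\<close>; a
  vertex may be attributed to either of its edges.\<close>

definition element_condition :: "plane set \<Rightarrow> plane set set \<Rightarrow> bool" where
  "element_condition \<Gamma> \<T> \<longleftrightarrow> (\<forall>K\<in>\<T>. \<exists>e1 e2 X1 X2.
     e1 edge_of K \<and> e2 edge_of K \<and> e1 \<noteq> e2 \<and> \<Gamma> \<inter> frontier K = X1 \<union> X2 \<and>
     X1 \<subseteq> e1 \<and> (X1 = e1 \<or> (\<exists>x. X1 \<subseteq> {x})) \<and>
     X2 \<subseteq> e2 \<and> (X2 = e2 \<or> (\<exists>x. X2 \<subseteq> {x})))"

definition normal_segment :: "(real \<Rightarrow> plane) \<Rightarrow> real \<Rightarrow> real \<Rightarrow> plane set" where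
  "normal_segment \<gamma> r s = closed_segment (\<gamma> s - r *\<^sub>R normal \<gamma> s) (\<gamma> s + r *\<^sub>R normal \<gamma> s)"

definition disjoint_normal_segments :: "(real \<Rightarrow> plane) \<Rightarrow> real \<Rightarrow> bool" where
  "disjoint_normal_segments \<gamma> r \<longleftrightarrow>
     (\<forall>s s'. \<gamma> s \<noteq> \<gamma> s' \<longrightarrow> normal_segment \<gamma> r s \<inter> normal_segment \<gamma> r s' = {})"

definition interface_elements :: "plane set \<Rightarrow> plane set set \<Rightarrow> plane set set" where
  "interface_elements \<Gamma> \<T> = {T \<in> \<T>. T \<inter> \<Gamma> \<noteq> {}}"

section \<open>Polynomials and Lagrange shape functions\<close>

text \<open>Polynomials are taken as functions on the whole plane. Since triangles have nonempty
  interior, this identifies a polynomial on \<open>T\<close> with its extension.\<close>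

definition poly_space :: "nat \<Rightarrow> (plane \<Rightarrow> real) set" where
  "poly_space p = {f. \<exists>a. f = (\<lambda>x. \<Sum>i\<le>p. \<Sum>j\<le>p - i. a i j * (x $ 1) ^ i * (x $ 2) ^ j)}"

definition vertices :: "plane set \<Rightarrow> plane set" where
  "vertices T = {x. x extreme_point_of T}"

text \<open>The points of \<open>T\<close> whose barycentric coordinates are multiples of \<open>1/p\<close>. The nodes
  themselves serve as the index set of the shape functions, i.e. \<open>A\<^sub>i\<close> and \<open>i\<close> are identified.\<close>

definition nodes :: "nat \<Rightarrow> plane set \<Rightarrow> plane set" where
  "nodes p T = {\<Sum>v\<in>vertices T. (real (k v) / real p) *\<^sub>R v |k :: plane \<Rightarrow> nat. sum k (vertices T) = p}"

definition shape_fun :: "nat \<Rightarrow> plane set \<Rightarrow> plane \<Rightarrow> plane \<Rightarrow> real" where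
  "shape_fun p T a =
     (THE f. f \<in> poly_space p \<and> (\<forall>b\<in>nodes p T. f b = (if b = a then 1 else 0)))"

text \<open>\<open>T\<^sup>+\<close>: taking closures attributes the points of \<open>T\<close> on \<open>\<partial>\<Omega>\<close> to the subdomain they bound.
  \<open>Q\<close> is an arbitrary convention for the points on \<open>\<Gamma>\<close>, which go to the plus side iff they lie
  in \<open>Q\<close>. The remaining points of \<open>T\<close> form \<open>T\<^sup>-\<close>.\<close>

definition plus_part :: "plane set \<Rightarrow> plane set \<Rightarrow> plane set \<Rightarrow> plane set \<Rightarrow> plane set" where
  "plus_part \<Gamma> \<Omega>p Q T = T \<inter> ((closure \<Omega>p - \<Gamma>) \<union> (\<Gamma> \<inter> Q))"

type_synonym fpair = "(plane \<Rightarrow> real) \<times> (plane \<Rightarrow> real)"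

definition glue :: "plane set \<Rightarrow> fpair \<Rightarrow> plane \<Rightarrow> real" where
  "glue Tp u x = (if x \<in> Tp then fst u x else snd u x)"

definition xi_basis :: "nat \<Rightarrow> plane set \<Rightarrow> plane set \<Rightarrow> plane \<Rightarrow> fpair" where
  "xi_basis p T Tp a =
     (if a \<in> Tp then (shape_fun p T a, \<lambda>_. 0) else (\<lambda>_. 0, shape_fun p T a))"

definition eta_basis :: "nat \<Rightarrow> plane set \<Rightarrow> plane set \<Rightarrow> plane \<Rightarrow> fpair" where
  "eta_basis p T Tp a =
     (if a \<in> Tp then (\<lambda>_. 0, shape_fun p T a) else (shape_fun p T a, \<lambda>_. 0))"

definition xi_eta_comb ::
  "nat \<Rightarrow> plane set \<Rightarrow> plane set \<Rightarrow> (plane \<Rightarrow> real) \<Rightarrow> (plane \<Rightarrow> real) \<Rightarrow> fpair" where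
  "xi_eta_comb p T Tp v c =
     (\<lambda>x. \<Sum>a\<in>nodes p T. v a * fst (xi_basis p T Tp a) x + c a * fst (eta_basis p T Tp a) x,
      \<lambda>x. \<Sum>a\<in>nodes p T. v a * snd (xi_basis p T Tp a) x + c a * snd (eta_basis p T Tp a) x)"

section \<open>The bilinear form\<close>

definition pd :: "2 \<Rightarrow> (plane \<Rightarrow> real) \<Rightarrow> plane \<Rightarrow> real" where
  "pd i f x = frechet_derivative f (at x) (axis i 1)"

definition laplacian :: "(plane \<Rightarrow> real) \<Rightarrow> plane \<Rightarrow> real" where
  "laplacian f x = (\<Sum>i\<in>UNIV. pd i (pd i f) x)"

definition d_n :: "plane \<Rightarrow> (plane \<Rightarrow> real) \<Rightarrow> plane \<Rightarrow> real" where
  "d_n n f x = (\<Sum>i\<in>UNIV. n $ i * pd i f x)"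

definition d_nn :: "plane \<Rightarrow> (plane \<Rightarrow> real) \<Rightarrow> plane \<Rightarrow> real" where
  "d_nn n f x = (\<Sum>i\<in>UNIV. \<Sum>j\<in>UNIV. n $ i * n $ j * pd i (pd j f) x)"

definition d_ntt :: "plane \<Rightarrow> plane \<Rightarrow> (plane \<Rightarrow> real) \<Rightarrow> plane \<Rightarrow> real" where
  "d_ntt n t f x =
     (\<Sum>i\<in>UNIV. \<Sum>j\<in>UNIV. \<Sum>k\<in>UNIV. n $ i * t $ j * t $ k * pd i (pd j (pd k f)) x)"

text \<open>Jumps at the interface point \<open>\<gamma> s\<close>.\<close>

definition jump0 :: "(real \<Rightarrow> plane) \<Rightarrow> fpair \<Rightarrow> real \<Rightarrow> real" where
  "jump0 \<gamma> u s = fst u (\<gamma> s) - snd u (\<gamma> s)"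

definition jump1 :: "(real \<Rightarrow> plane) \<Rightarrow> fpair \<Rightarrow> real \<Rightarrow> real" where
  "jump1 \<gamma> u s = d_n (normal \<gamma> s) (fst u) (\<gamma> s) - d_n (normal \<gamma> s) (snd u) (\<gamma> s)"

definition jump2 :: "(real \<Rightarrow> plane) \<Rightarrow> real \<Rightarrow> real \<Rightarrow> fpair \<Rightarrow> real \<Rightarrow> real" where
  "jump2 \<gamma> \<beta>p \<beta>m u s =
     \<beta>p * d_nn (normal \<gamma> s) (fst u) (\<gamma> s) - \<beta>m * d_nn (normal \<gamma> s) (snd u) (\<gamma> s)"

definition jump3 :: "(real \<Rightarrow> plane) \<Rightarrow> real \<Rightarrow> real \<Rightarrow> fpair \<Rightarrow> real \<Rightarrow> real" where
  "jump3 \<gamma> \<beta>p \<beta>m u s =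
     (let D = (\<lambda>f. d_n (normal \<gamma> s) (laplacian f) (\<gamma> s)
                   + d_ntt (normal \<gamma> s) (tangent \<gamma> s) f (\<gamma> s))
      in \<beta>p * D (fst u) - \<beta>m * D (snd u))"

definition fictitious_element :: "real \<Rightarrow> plane set \<Rightarrow> plane set" where
  "fictitious_element lam T =
     (let B = (1 / 3) *\<^sub>R (\<Sum>v\<in>vertices T. v)
      in {X. \<exists>Y\<in>T. X - B = lam *\<^sub>R (Y - B)})"

text \<open>Arc length integral over \<open>X \<inter> \<Gamma>\<close> of a function given in terms of the curve parameter.\<close>

definition curve_integral :: "(real \<Rightarrow> plane) \<Rightarrow> plane set \<Rightarrow> (real \<Rightarrow> real) \<Rightarrow> real" where
  "curve_integral \<gamma> X f =
     (LINT s:{s \<in> {0..1}. \<gamma> s \<in> X}|lborel. f s * norm (vector_derivative \<gamma> (at s)))"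

definition J_form ::
  "(real \<Rightarrow> plane) \<Rightarrow> real \<Rightarrow> real \<Rightarrow> (nat \<Rightarrow> real) \<Rightarrow> real \<Rightarrow> real \<Rightarrow> plane set \<Rightarrow>
   fpair \<Rightarrow> fpair \<Rightarrow> real" where
  "J_form \<gamma> \<beta>p \<beta>m \<omega> lam h T u v =
     (let I = curve_integral \<gamma> (fictitious_element lam T)
      in \<omega> 0 * I (\<lambda>s. jump0 \<gamma> u s * jump0 \<gamma> v s)
         + \<omega> 1 * h ^ 2 * I (\<lambda>s. jump1 \<gamma> u s * jump1 \<gamma> v s)
         + \<omega> 2 * h ^ 4 * I (\<lambda>s. jump2 \<gamma> \<beta>p \<beta>m u s * jump2 \<gamma> \<beta>p \<beta>m v s)
         + \<omega> 3 * h ^ 6 * I (\<lambda>s. jump3 \<gamma> \<beta>p \<beta>m u s * jump3 \<gamma> \<beta>p \<beta>m v s))"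

section \<open>IFE functions\<close>

text \<open>In the following, \<open>J\<close> stands for the bilinear form of the element \<open>T\<close> and \<open>Tp\<close> for \<open>T\<^sup>+\<close>.\<close>

definition is_ife_pair ::
  "(fpair \<Rightarrow> fpair \<Rightarrow> real) \<Rightarrow> nat \<Rightarrow> plane set \<Rightarrow> plane set \<Rightarrow> (plane \<Rightarrow> real) \<Rightarrow> fpair \<Rightarrow> bool" where
  "is_ife_pair J p T Tp v \<phi> \<longleftrightarrow>
     (\<exists>c. \<phi> = xi_eta_comb p T Tp v c) \<and> (\<forall>a\<in>nodes p T. J \<phi> (eta_basis p T Tp a) = 0)"

definition ife_unisolvent ::
  "(fpair \<Rightarrow> fpair \<Rightarrow> real) \<Rightarrow> nat \<Rightarrow> plane set \<Rightarrow> plane set \<Rightarrow> bool" where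
  "ife_unisolvent J p T Tp \<longleftrightarrow> (\<forall>v. \<exists>!\<phi>. is_ife_pair J p T Tp v \<phi>)"

definition ife_pair ::
  "(fpair \<Rightarrow> fpair \<Rightarrow> real) \<Rightarrow> nat \<Rightarrow> plane set \<Rightarrow> plane set \<Rightarrow> (plane \<Rightarrow> real) \<Rightarrow> fpair" where
  "ife_pair J p T Tp v = (THE \<phi>. is_ife_pair J p T Tp v \<phi>)"

definition ife_basis ::
  "(fpair \<Rightarrow> fpair \<Rightarrow> real) \<Rightarrow> nat \<Rightarrow> plane set \<Rightarrow> plane set \<Rightarrow> plane \<Rightarrow> plane \<Rightarrow> real" where
  "ife_basis J p T Tp a = glue Tp (ife_pair J p T Tp (\<lambda>b. if b = a then 1 else 0))"

end

theory Submission
  imports Defs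
begin

text \<open>The pair \<open>(1, 1)\<close> has nodal values 1, because the shape functions sum to 1. Its jumps vanish:
  in \<open>J\<close> the coefficient \<open>\<beta>\<close> only multiplies derivatives of positive order. So it is the IFE
  pair of the nodal value vector \<open>(1, \<dots>, 1)\<close>. As the bilinear form is linear in its first
  argument, the sum of the basis pairs is an IFE pair of the same vector, and unisolvence
  identifies the two.\<close>

section \<open>Bivariate polynomials\<close>

text \<open>Two facts quoted above carry most of the work. \<open>shape_fun\<close> is a definite
  description, so summing the shape functions to 1 rests on unisolvence of Lagrange interpolation on
  a triangle: existence comes from the classical product formula, uniqueness from an affine pullback
  to the integer grid. And additivity of the integral asks for integrable summands, so linearity of
  \<open>J\<close> rests on continuity of all jumps along the curve and on measurability of the set
  of parameters over which one integrates. Closure of \<open>poly_space\<close> under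
  \<open>pd\<close> serves both linearity and continuity, since the jumps contain derivatives up to
  order three. The pair \<open>(1, 1)\<close> is reached by taking all eta coefficients equal to 1
  as well.\<close>

lemma poly_spaceI: "f = (\<lambda>x. \<Sum>i\<le>p. \<Sum>j\<le>p - i. a i j * (x $ 1) ^ i * (x $ 2) ^ j) \<Longrightarrow> f \<in> poly_space p"
  unfolding poly_space_def by blast

lemma poly_spaceE:
  assumes "f \<in> poly_space p"
  obtains a where "f = (\<lambda>x. \<Sum>i\<le>p. \<Sum>j\<le>p - i. a i j * (x $ 1) ^ i * (x $ 2) ^ j)"
  using assms unfolding poly_space_def by blast

lemma poly_space_add [intro]:
  assumes "f \<in> poly_space p" "g \<in> poly_space p"
  shows "(\<lambda>x. f x + g x) \<in> poly_space p"
proof -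
  obtain a where a: "f = (\<lambda>x. \<Sum>i\<le>p. \<Sum>j\<le>p - i. a i j * (x $ 1) ^ i * (x $ 2) ^ j)"
    using assms(1) by (rule poly_spaceE)
  obtain b where b: "g = (\<lambda>x. \<Sum>i\<le>p. \<Sum>j\<le>p - i. b i j * (x $ 1) ^ i * (x $ 2) ^ j)"
    using assms(2) by (rule poly_spaceE)
  show ?thesis
    by (rule poly_spaceI[where a = "\<lambda>i j. a i j + b i j"]) (simp add: a b sum.distrib algebra_simps)
qed

lemma poly_space_cmult [intro]:
  assumes "f \<in> poly_space p"
  shows "(\<lambda>x. c * f x) \<in> poly_space p"
proof -
  obtain a where a: "f = (\<lambda>x. \<Sum>i\<le>p. \<Sum>j\<le>p - i. a i j * (x $ 1) ^ i * (x $ 2) ^ j)"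
    using assms(1) by (rule poly_spaceE)
  show ?thesis
    by (rule poly_spaceI[where a = "\<lambda>i j. c * a i j"]) (simp add: a sum_distrib_left mult.assoc)
qed

lemma monomial_in_poly_space:
  assumes "i + j \<le> p"
  shows "(\<lambda>x. (x $ 1) ^ i * (x $ 2) ^ j) \<in> poly_space p"
proof (rule poly_spaceI[where a = "\<lambda>k l. if k = i \<and> l = j then 1 else 0"], rule ext)
  fix x :: plane
  have "(\<Sum>k\<le>p. \<Sum>l\<le>p - k. (if k = i \<and> l = j then 1 else 0) * (x $ 1) ^ k * (x $ 2) ^ l)
      = (\<Sum>k\<le>p. if k = i then (\<Sum>l\<le>p - i. if l = j then (x $ 1) ^ i * (x $ 2) ^ j else 0) else 0)"
    by (intro sum.cong refl) (auto simp: if_distrib[of "\<lambda>c. c * _"] cong: if_cong)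
  also have "\<dots> = (x $ 1) ^ i * (x $ 2) ^ j"
    using assms by simp
  finally show "(x $ 1) ^ i * (x $ 2) ^ j =
      (\<Sum>k\<le>p. \<Sum>l\<le>p - k. (if k = i \<and> l = j then 1 else 0) * (x $ 1) ^ k * (x $ 2) ^ l)" ..
qed

lemma poly_space_const [intro]: "(\<lambda>_. c) \<in> poly_space p"
  using poly_space_cmult[OF monomial_in_poly_space[of 0 0 p], of c] by simp

lemma poly_space_sum [intro]:
  assumes "\<And>a. a \<in> A \<Longrightarrow> f a \<in> poly_space p"
  shows "(\<lambda>x. \<Sum>a\<in>A. f a x) \<in> poly_space p"
  using assms by (induction A rule: infinite_finite_induct) auto

text \<open>Linear closure properties need checking on monomials only. The membership premises of
  the \<open>add\<close> and \<open>cmult\<close> cases are what \<open>pd_add\<close> and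
  \<open>pd_cmult\<close> ask for.\<close>

lemma poly_space_induct [consumes 1, case_names monomial add cmult zero]:
  assumes "f \<in> poly_space p"
    and monomial: "\<And>i j. i + j \<le> p \<Longrightarrow> P (\<lambda>x. (x $ 1) ^ i * (x $ 2) ^ j)"
    and add: "\<And>f g. f \<in> poly_space p \<Longrightarrow> g \<in> poly_space p \<Longrightarrow> P f \<Longrightarrow> P g \<Longrightarrow> P (\<lambda>x. f x + g x)"
    and cmult: "\<And>c f. f \<in> poly_space p \<Longrightarrow> P f \<Longrightarrow> P (\<lambda>x. c * f x)"
    and zero: "P (\<lambda>_. 0)"
  shows "P f"
proof -
  obtain a where a: "f = (\<lambda>x. \<Sum>i\<le>p. \<Sum>j\<le>p - i. a i j * (x $ 1) ^ i * (x $ 2) ^ j)"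
    using assms(1) by (rule poly_spaceE)
  \<comment> \<open>Membership is carried along with \<open>P\<close> because \<open>add\<close>
    asks for it of both summands.\<close>
  have sum: "(\<lambda>x. \<Sum>k\<in>A. g k x) \<in> poly_space p \<and> P (\<lambda>x. \<Sum>k\<in>A. g k x)"
    if "finite A" "\<And>k. k \<in> A \<Longrightarrow> g k \<in> poly_space p \<and> P (g k)" for A :: "nat set" and g
    using that by (induction A rule: finite_induct) (auto intro: add zero)
  have "(\<lambda>x. a i j * (x $ 1) ^ i * (x $ 2) ^ j) \<in> poly_space p
      \<and> P (\<lambda>x. a i j * (x $ 1) ^ i * (x $ 2) ^ j)" if "i \<le> p" "j \<le> p - i" for i j
  proof -
    have "i + j \<le> p" using that by simp
    then show ?thesis
      using cmult[OF monomial_in_poly_space monomial, of i j "a i j"]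
        poly_space_cmult[OF monomial_in_poly_space, of i j p "a i j"]
      by (simp add: mult.assoc)
  qed
  then have "f \<in> poly_space p \<and> P f"
    unfolding a by (intro sum) auto
  then show ?thesis ..
qed

lemma poly_space_mono:
  assumes "f \<in> poly_space p" "p \<le> q"
  shows "f \<in> poly_space q"
  using assms(1)
proof (induction rule: poly_space_induct)
  case (monomial i j)
  then show ?case using assms(2) by (intro monomial_in_poly_space) simp
qed auto

lemma poly_space_mult:
  assumes "f \<in> poly_space p" "g \<in> poly_space q"
  shows "(\<lambda>x. f x * g x) \<in> poly_space (p + q)"
  using assms(1)
proof (induction rule: poly_space_induct)
  case (monomial i j)
  show ?case
    using assms(2)
  proof (induction rule: poly_space_induct)
    case (monomial k l)
    have "(\<lambda>x. (x $ 1) ^ (i + k) * (x $ 2) ^ (j + l)) \<in> poly_space (p + q)"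
      using \<open>i + j \<le> p\<close> monomial by (intro monomial_in_poly_space) simp
    then show ?case by (simp add: power_add mult_ac)
  next
    case (cmult c f)
    then show ?case
      using poly_space_cmult[of _ "p + q" c] by (simp add: mult.left_commute)
  qed (auto simp: distrib_left)
qed (auto simp: distrib_right mult.assoc)

lemma poly_space_power:
  assumes "f \<in> poly_space 1"
  shows "(\<lambda>x. f x ^ n) \<in> poly_space n"
proof (induction n)
  case (Suc n)
  show ?case using poly_space_mult[OF assms Suc] by simp
qed auto

lemma poly_space_prod:
  assumes "\<And>a. a \<in> A \<Longrightarrow> f a \<in> poly_space (d a)"
  shows "(\<lambda>x. \<Prod>a\<in>A. f a x) \<in> poly_space (sum d A)"
  using assms
  by (induction A rule: infinite_finite_induct) (auto intro: poly_space_mult)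

text \<open>An affine substitution does not raise the degree: a monomial of degree
  \<open>i + j\<close> becomes a product of \<open>i + j\<close> affine factors.\<close>

lemma poly_space_compose:
  assumes "f \<in> poly_space p" "g1 \<in> poly_space 1" "g2 \<in> poly_space 1"
    and "\<And>x. h x $ 1 = g1 x" "\<And>x. h x $ 2 = g2 x"
  shows "(\<lambda>x. f (h x)) \<in> poly_space p"
  using assms(1)
proof (induction rule: poly_space_induct)
  case (monomial i j)
  have "(\<lambda>x. g1 x ^ i * g2 x ^ j) \<in> poly_space (i + j)"
    by (intro poly_space_mult poly_space_power assms)
  then show ?case using monomial by (auto simp: assms intro: poly_space_mono)
qed auto

lemma coordinate_in_poly_space:
  "0 < p \<Longrightarrow> (\<lambda>x. x $ 1) \<in> poly_space p" "0 < p \<Longrightarrow> (\<lambda>x. x $ 2) \<in> poly_space p"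
  using monomial_in_poly_space[of 1 0 p] monomial_in_poly_space[of 0 1 p] by auto

lemma poly_space_differentiable:
  assumes "f \<in> poly_space p"
  shows "f differentiable (at x)"
  using assms
proof (induction rule: poly_space_induct)
  case (monomial i j)
  have "(\<lambda>x::plane. x $ k) differentiable (at x)" for k
    by (intro bounded_linear_imp_differentiable bounded_linear_vec_nth)
  then show ?case by (intro differentiable_mult differentiable_power)
qed auto

lemma poly_space_continuous_on: "f \<in> poly_space p \<Longrightarrow> continuous_on S f"
  by (meson continuous_at_imp_continuous_on differentiable_imp_continuous_within
      poly_space_differentiable)

section \<open>Lagrange interpolation on a triangle\<close>

lemma poly_space_shift:
  assumes "f \<in> poly_space p"
  shows "(\<lambda>x. f (x + v)) \<in> poly_space p"
proof (rule poly_space_compose[OF assms])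
  show "(\<lambda>x. x $ 1 + v $ 1) \<in> poly_space 1" "(\<lambda>x. x $ 2 + v $ 2) \<in> poly_space 1"
    by (intro poly_space_add coordinate_in_poly_space poly_space_const; simp)+
qed simp_all

text \<open>By induction on the degree: a polynomial vanishing on the grid vanishes on the line
  \<open>x $ 1 = 0\<close>, so it is \<open>x $ 1\<close> times a polynomial that vanishes on the shifted smaller grid.\<close>

lemma poly_space_eq_0_if_grid_eq_0:
  assumes "f \<in> poly_space p"
    and "\<And>i j. i + j \<le> p \<Longrightarrow> f (vector [real i, real j]) = 0"
  shows "f x = 0"
  using assms
proof (induction p arbitrary: f x)
  case 0
  from 0(1) obtain a where "f = (\<lambda>x. \<Sum>i\<le>0. \<Sum>j\<le>0 - i. a i j * (x $ 1) ^ i * (x $ 2) ^ j)"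
    by (rule poly_spaceE)
  then show ?case using 0(2)[of 0 0] by simp
next
  case (Suc p)
  obtain a where a:
    "f = (\<lambda>x. \<Sum>i\<le>Suc p. \<Sum>j\<le>Suc p - i. a i j * (x $ 1) ^ i * (x $ 2) ^ j)"
    using Suc.prems(1) by (rule poly_spaceE)
  define g where "g = (\<lambda>x::plane. \<Sum>i\<le>p. \<Sum>j\<le>p - i. a (Suc i) j * (x $ 1) ^ i * (x $ 2) ^ j)"
  have f_split: "f x = (\<Sum>j\<le>Suc p. a 0 j * (x $ 2) ^ j) + x $ 1 * g x" for x
    unfolding a g_def
    by (subst sum.atMost_Suc_shift) (simp add: sum_distrib_left mult_ac)
  \<comment> \<open>On the line \<open>x $ 1 = 0\<close> the polynomial is univariate of degree at
    most \<open>p + 1\<close>, but has the \<open>p + 2\<close> roots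
    \<open>0, ..., p + 1\<close>.\<close>
  have "a 0 j = 0" if "j \<le> Suc p" for j
  proof (rule ccontr)
    assume "a 0 j \<noteq> 0"
    then have fin: "finite {z. (\<Sum>j\<le>Suc p. a 0 j * z ^ j) = 0}"
      and card: "card {z. (\<Sum>j\<le>Suc p. a 0 j * z ^ j) = 0} \<le> Suc p"
      using polyfun_rootbound[of "Suc p" "a 0"] that by blast+
    have "real ` {..Suc p} \<subseteq> {z. (\<Sum>j\<le>Suc p. a 0 j * z ^ j) = 0}"
    proof (intro image_subsetI CollectI)
      fix i assume "i \<in> {..Suc p}"
      then show "(\<Sum>j\<le>Suc p. a 0 j * real i ^ j) = 0"
        using Suc.prems(2)[of 0 i] unfolding f_split by simp
    qed
    then have "card (real ` {..Suc p}) \<le> Suc p"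
      using card_mono[OF fin] card by (meson le_trans)
    then show False
      by (simp add: card_image)
  qed
  then have f_eq: "f x = x $ 1 * g x" for x
    unfolding f_split by simp
  \<comment> \<open>The factor \<open>x $ 1\<close> can be cancelled only at grid points with first
    coordinate at least 1; the shift moves these onto the grid of the induction hypothesis.\<close>
  have "g (x + vector [1, 0]) = 0" for x
  proof (rule Suc.IH[of "\<lambda>x. g (x + vector [1, 0])"])
    show "(\<lambda>x. g (x + vector [1, 0])) \<in> poly_space p"
      by (intro poly_space_shift poly_spaceI[OF g_def])
    fix i j assume "i + j \<le> p"
    then have "f (vector [real (Suc i), real j]) = 0"
      by (intro Suc.prems(2)) simp
    moreover have "vector [real i, real j] + vector [1, 0] = (vector [real (Suc i), real j] :: plane)"
      by (simp add: vec_eq_iff forall_2)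
    ultimately show "g (vector [real i, real j] + vector [1, 0]) = 0"
      by (simp add: f_eq)
  qed
  then have "g x = 0" for x
    by (metis diff_add_cancel)
  then show ?case by (simp add: f_eq)
qed

section \<open>Barycentric coordinates\<close>

lemma parallel_if_cross_eq_0:
  fixes u w :: plane
  assumes "u $ 1 * w $ 2 = u $ 2 * w $ 1" "u \<noteq> 0"
  shows "\<exists>k. w = k *\<^sub>R u"
proof (cases "u $ 1 = 0")
  case True
  then have "u $ 2 \<noteq> 0"
    using assms(2) by (auto simp: vec_eq_iff forall_2)
  then show ?thesis
    using assms(1) True
    by (intro exI[of _ "w $ 2 / u $ 2"]) (simp add: vec_eq_iff forall_2)
next
  case False
  then show ?thesis
    using assms(1)
    by (intro exI[of _ "w $ 1 / u $ 1"]) (simp add: vec_eq_iff forall_2 field_simps)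
qed

text \<open>Cramer's rule: the coordinate of a vertex is a quotient of signed areas. The second
  clause recovers a point from its coordinates, for uniqueness of interpolation; the last reads off
  the weights of an affine combination, for values at nodes.\<close>

lemma barycentric_coordinates:
  fixes C :: "plane set"
  assumes "\<not> affine_dependent C" "card C = 3"
  shows "\<exists>L. (\<forall>v\<in>C. L v \<in> poly_space 1) \<and>
      (\<forall>x. (\<Sum>v\<in>C. L v x) = 1 \<and> (\<Sum>v\<in>C. L v x *\<^sub>R v) = x) \<and>
      (\<forall>w. sum w C = 1 \<longrightarrow> (\<forall>v\<in>C. L v (\<Sum>u\<in>C. w u *\<^sub>R u) = w v))"
proof -
  obtain a b c where C: "C = {a, b, c}" and distinct: "a \<noteq> b" "b \<noteq> c" "a \<noteq> c"
    using \<open>card C = 3\<close> by (auto simp: card_3_iff)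
  define cross where "cross = (\<lambda>(u :: plane) (w :: plane). u $ 1 * w $ 2 - u $ 2 * w $ 1)"
  \<comment> \<open>Twice the signed area of the triangle. If it were 0, two edge vectors would be
    parallel and the vertices collinear.\<close>
  define d where "d = cross (b - a) (c - a)"
  have "d \<noteq> 0"
  proof
    assume "d = 0"
    let ?u = "b - a" and ?w = "c - a"
    have "?u $ 1 * ?w $ 2 = ?u $ 2 * ?w $ 1" "?u \<noteq> 0"
      using \<open>d = 0\<close> distinct by (simp_all add: d_def cross_def)
    then have "\<exists>k. ?w = k *\<^sub>R ?u"
      by (rule parallel_if_cross_eq_0)
    then have "collinear {0, ?u, ?w}"
      by (simp add: collinear_lemma)
    then have "collinear {b, a, c}"
      by (subst collinear_3) simp_all
    then show False
      using assms(1) distinct C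
      by (auto simp: collinear_3_eq_affine_dependent insert_commute)
  qed
  define Lb where "Lb = (\<lambda>x. cross (x - a) (c - a) / d)"
  define Lc where "Lc = (\<lambda>x. cross (b - a) (x - a) / d)"
  \<comment> \<open>The coordinate of \<open>a\<close> is the complement of the other two, so the
    sum is 1 by construction.\<close>
  define L where "L = (\<lambda>v. if v = b then Lb else if v = c then Lc else (\<lambda>x. 1 - Lb x - Lc x))"
  have sum_C: "sum f C = f a + f b + f c" for f :: "plane \<Rightarrow> 'z::comm_monoid_add"
    using distinct by (simp add: C add.assoc)
  have L: "L a = (\<lambda>x. 1 - Lb x - Lc x)" "L b = Lb" "L c = Lc"
    using distinct by (auto simp: L_def)
  have affine: "(\<lambda>x. k + l * x $ 1 + m * x $ 2) \<in> poly_space 1" for k l m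
    by (intro poly_space_add poly_space_const poly_space_cmult coordinate_in_poly_space) simp_all
  show ?thesis
  proof (intro exI[of _ L] conjI ballI allI impI)
    have "cross (x - a) u = (a $ 2 * u $ 1 - a $ 1 * u $ 2) + u $ 2 * x $ 1 + (- u $ 1) * x $ 2"
      and "cross u (x - a) = (a $ 1 * u $ 2 - a $ 2 * u $ 1) + (- u $ 2) * x $ 1 + u $ 1 * x $ 2" for x u
      by (simp_all add: cross_def algebra_simps)
    then have "(\<lambda>x. cross (x - a) u) \<in> poly_space 1" "(\<lambda>x. cross u (x - a)) \<in> poly_space 1" for u
      by (simp_all only: affine)
    from this[THEN poly_space_cmult[of _ _ "1 / d"]]
    have Lb: "Lb \<in> poly_space 1" and Lc: "Lc \<in> poly_space 1"
      by (simp_all add: Lb_def Lc_def)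
    have "(\<lambda>x. 1 + (- 1) * Lb x + (- 1) * Lc x) \<in> poly_space 1"
      by (intro poly_space_add poly_space_const poly_space_cmult Lb Lc)
    then show "L v \<in> poly_space 1" for v
      using Lb Lc by (auto simp: L_def)
    show "(\<Sum>v\<in>C. L v x) = 1" for x
      by (simp add: sum_C L)
    show "(\<Sum>v\<in>C. L v x *\<^sub>R v) = x" for x
    proof -
      \<comment> \<open>After multiplication by \<open>d\<close> no quotient is left, and the claim
        is a polynomial identity in the coordinates.\<close>
      have "d * (a $ i + Lb x * (b - a) $ i + Lc x * (c - a) $ i) = d * x $ i" for i
      proof -
        have "d * Lb x = cross (x - a) (c - a)" "d * Lc x = cross (b - a) (x - a)"
          using \<open>d \<noteq> 0\<close> by (simp_all add: Lb_def Lc_def)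
        then have "d * (a $ i + Lb x * (b - a) $ i + Lc x * (c - a) $ i)
            = d * a $ i + cross (x - a) (c - a) * (b - a) $ i + cross (b - a) (x - a) * (c - a) $ i"
          by (simp only: distrib_left flip: mult.assoc)
        also have "\<dots> = d * x $ i"
          using exhaust_2[of i] by (auto simp: d_def cross_def algebra_simps)
        finally show ?thesis .
      qed
      then have "a + Lb x *\<^sub>R (b - a) + Lc x *\<^sub>R (c - a) = x"
        using \<open>d \<noteq> 0\<close> by (simp add: vec_eq_iff)
      then show ?thesis
        by (simp add: sum_C L algebra_simps)
    qed
    show "L v (\<Sum>u\<in>C. w u *\<^sub>R u) = w v" if "sum w C = 1" "v \<in> C" for w v
    proof -
      have wa: "w a = 1 - w b - w c"
        using that(1) by (simp add: sum_C)
      have "(\<Sum>u\<in>C. w u *\<^sub>R u) - a = w b *\<^sub>R (b - a) + w c *\<^sub>R (c - a)" (is "?x - a = _")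
        by (simp add: sum_C wa algebra_simps)
      then have "cross (?x - a) (c - a) = w b * d" "cross (b - a) (?x - a) = w c * d"
        by (simp_all only:) (simp_all add: cross_def d_def algebra_simps)
      then have "Lb ?x = w b" "Lc ?x = w c"
        using \<open>d \<noteq> 0\<close> by (simp_all add: Lb_def Lc_def)
      then show ?thesis
        using that(2) L wa by (auto simp: C)
    qed
  qed
qed

section \<open>Nodes and the Lagrange basis\<close>

lemma triangleE:
  fixes T :: "plane set"
  assumes "2 simplex T"
  obtains "\<not> affine_dependent (vertices T)" "card (vertices T) = 3" "T = convex hull (vertices T)"
proof -
  obtain C where C: "\<not> affine_dependent C" "card C = 3" "T = convex hull C"
    using assms by (auto simp: simplex_def)
  then have "vertices T = C"
    by (auto simp: vertices_def extreme_point_of_convex_hull_affine_independent)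
  then show thesis using C that by simp
qed

text \<open>The functions \<open>k\<close> are arbitrary off the vertices, but a node depends only
  on the restriction to the vertices, where the values are at most \<open>p\<close>. Finiteness
  matters because a sum over an infinite set is 0 by default.\<close>

lemma finite_nodes:
  assumes "finite (vertices T)"
  shows "finite (nodes p T)"
proof (rule finite_subset)
  let ?node = "\<lambda>k. \<Sum>v\<in>vertices T. (real (k v) / real p) *\<^sub>R v"
  show "finite (?node ` (vertices T \<rightarrow>\<^sub>E {..p}))"
    using assms by (simp add: finite_PiE)
  show "nodes p T \<subseteq> ?node ` (vertices T \<rightarrow>\<^sub>E {..p})"
  proof
    fix a assume "a \<in> nodes p T"
    then obtain k where k: "a = ?node k" "sum k (vertices T) = p"
      by (auto simp: nodes_def)
    have "a = ?node (restrict k (vertices T))"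
      by (simp add: k)
    moreover have "k v \<le> p" if "v \<in> vertices T" for v
      using member_le_sum[OF that, of k] assms k by simp
    ultimately show "a \<in> ?node ` (vertices T \<rightarrow>\<^sub>E {..p})"
      by (intro image_eqI[where x = "restrict k (vertices T)"]) auto
  qed
qed

lemma Lagrange_existence:
  assumes "2 simplex T" "0 < p" "a \<in> nodes p T"
  shows "\<exists>f\<in>poly_space p. \<forall>b\<in>nodes p T. f b = (if b = a then 1 else 0)"
proof -
  let ?C = "vertices T"
  have C: "\<not> affine_dependent ?C" "card ?C = 3"
    using assms(1) by (auto elim: triangleE)
  then have fin: "finite ?C" by (simp add: card_ge_0_finite)
  obtain L where L1: "\<And>v. v \<in> ?C \<Longrightarrow> L v \<in> poly_space 1"
    and L_sum: "\<And>x. (\<Sum>v\<in>?C. L v x) = 1" and L_comb: "\<And>x. (\<Sum>v\<in>?C. L v x *\<^sub>R v) = x"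
    and L: "\<And>w v. sum w ?C = 1 \<Longrightarrow> v \<in> ?C \<Longrightarrow> L v (\<Sum>u\<in>?C. w u *\<^sub>R u) = w v"
    using barycentric_coordinates[OF C] by blast
  have L_node: "p * L v (\<Sum>u\<in>?C. (real (k u) / real p) *\<^sub>R u) = real (k v)"
    if "sum k ?C = p" "v \<in> ?C" for k v
  proof -
    have "(\<Sum>u\<in>?C. real (k u) / real p) = 1"
      using that assms(2) by (simp flip: sum_divide_distrib of_nat_sum)
    then show ?thesis using L[of "\<lambda>u. real (k u) / real p" v] that assms(2) by simp
  qed
  obtain k where k: "a = (\<Sum>v\<in>?C. (real (k v) / real p) *\<^sub>R v)" "sum k ?C = p"
    using assms(3) by (auto simp: nodes_def)
  \<comment> \<open>The classical Lagrange basis function: the numerators vanish on the lines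
    \<open>p * L v = l\<close> with \<open>l < k v\<close>, the denominators normalize the value at
    \<open>a\<close> to 1, and there are \<open>sum k ?C = p\<close> affine factors.\<close>
  define f where "f = (\<lambda>x. \<Prod>v\<in>?C. \<Prod>l<k v. (p * L v x - real l) / (real (k v) - real l))"
  show ?thesis
  proof (intro bexI[of _ f] ballI)
    have "(\<lambda>x. (p * L v x - real l) / (real (k v) - real l)) \<in> poly_space 1"
      if "v \<in> ?C" for v l
    proof -
      have "(\<lambda>x. inverse (real (k v) - real l) * (p * L v x + - real l)) \<in> poly_space 1"
        by (intro poly_space_cmult poly_space_add poly_space_const L1 that)
      then show ?thesis by (simp add: divide_inverse mult.commute)
    qed
    then have "(\<lambda>x. \<Prod>l<k v. (p * L v x - real l) / (real (k v) - real l)) \<in> poly_space (k v)"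
      if "v \<in> ?C" for v
      using poly_space_prod[of "{..<k v}" _ "\<lambda>_. 1"] that by simp
    then have "f \<in> poly_space (sum k ?C)"
      unfolding f_def by (rule poly_space_prod)
    then show "f \<in> poly_space p" by (simp add: k)
    fix b assume "b \<in> nodes p T"
    then obtain m where m: "b = (\<Sum>v\<in>?C. (real (m v) / real p) *\<^sub>R v)" "sum m ?C = p"
      by (auto simp: nodes_def)
    then have f_b: "f b = (\<Prod>v\<in>?C. \<Prod>l<k v. (real (m v) - real l) / (real (k v) - real l))"
      unfolding f_def by (simp add: L_node)
    show "f b = (if b = a then 1 else 0)"
    \<comment> \<open>Index vectors with the same sum \<open>p\<close> coincide once one dominates
      the other. Otherwise the factor with \<open>l = m v\<close> vanishes at \<open>b\<close> for
      some vertex \<open>v\<close>.\<close>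
    proof (cases "\<forall>v\<in>?C. k v \<le> m v")
      case True
      then have eq: "k v = m v" if "v \<in> ?C" for v
        using sum_mono_inv[of k ?C m v] k m fin that by simp
      then have "b = a" by (simp add: k m)
      moreover have "f b = 1"
        unfolding f_b by (intro prod.neutral ballI) (simp add: eq)
      ultimately show ?thesis by simp
    next
      case False
      then obtain v where v: "v \<in> ?C" "m v < k v" by auto
      then have "f b = 0"
        unfolding f_b using fin by (intro prod_zero bexI[of _ v] bexI[of _ "m v"]) auto
      moreover have "b \<noteq> a"
      proof
        assume "b = a"
        then have "real (m v) = real (k v)"
          using L_node[OF m(2) v(1)] L_node[OF k(2) v(1)] k m by simp
        then show False using v by simp
      qed
      ultimately show ?thesis by simp
    qed
  qed
qed

text \<open>An affine bijection takes the integer grid to the nodes, so the pullback of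
  \<open>f - g\<close> vanishes on the grid and hence everywhere.\<close>

lemma Lagrange_uniqueness:
  assumes "2 simplex T" "0 < p" "f \<in> poly_space p" "g \<in> poly_space p"
    and eq: "\<And>b. b \<in> nodes p T \<Longrightarrow> f b = g b"
  shows "f = g"
proof
  fix x
  let ?C = "vertices T"
  have C: "\<not> affine_dependent ?C" "card ?C = 3"
    using assms(1) by (auto elim: triangleE)
  obtain L where L1: "\<And>v. v \<in> ?C \<Longrightarrow> L v \<in> poly_space 1"
    and L_sum: "\<And>x. (\<Sum>v\<in>?C. L v x) = 1" and L_comb: "\<And>x. (\<Sum>v\<in>?C. L v x *\<^sub>R v) = x"
    and L: "\<And>w v. sum w ?C = 1 \<Longrightarrow> v \<in> ?C \<Longrightarrow> L v (\<Sum>u\<in>?C. w u *\<^sub>R u) = w v"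
    using barycentric_coordinates[OF C] by blast
  obtain a b c where abc: "?C = {a, b, c}" and distinct: "a \<noteq> b" "b \<noteq> c" "a \<noteq> c"
    using \<open>card ?C = 3\<close> by (auto simp: card_3_iff)
  have sum_C: "sum h ?C = h a + h b + h c" for h :: "plane \<Rightarrow> 'z::comm_monoid_add"
    using distinct by (simp add: abc add.assoc)
  \<comment> \<open>Sends the grid point \<open>(i, j)\<close> to the node with indices
    \<open>p - i - j\<close>, \<open>i\<close>, \<open>j\<close> at \<open>a\<close>,
    \<open>b\<close>, \<open>c\<close>.\<close>
  define A where "A = (\<lambda>y::plane. a + (y $ 1 / p) *\<^sub>R (b - a) + (y $ 2 / p) *\<^sub>R (c - a))"
  define h where "h = (\<lambda>y. f (A y) + (- 1) * g (A y))"
  have affine: "(\<lambda>y. A y $ i) \<in> poly_space 1" for i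
  proof -
    have "(\<lambda>y. a $ i + ((b - a) $ i / p) * y $ 1 + ((c - a) $ i / p) * y $ 2) \<in> poly_space 1"
      by (intro poly_space_add poly_space_const poly_space_cmult coordinate_in_poly_space) simp_all
    then show ?thesis by (simp add: A_def mult.commute)
  qed
  have "h y = 0" for y
  proof (rule poly_space_eq_0_if_grid_eq_0)
    show "h \<in> poly_space p"
      unfolding h_def
      by (intro poly_space_add poly_space_cmult poly_space_compose[OF assms(3) affine affine]
          poly_space_compose[OF assms(4) affine affine]) simp_all
    fix i j :: nat assume ij: "i + j \<le> p"
    define k where "k = (\<lambda>v. if v = b then i else if v = c then j else p - i - j)"
    have k: "k a = p - i - j" "k b = i" "k c = j"
      using distinct by (auto simp: k_def)
    have ka: "real (k a) / p = 1 - i / p - j / p"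
      using ij assms(2) by (simp add: k of_nat_diff field_simps)
    have "A (vector [real i, real j]) = (\<Sum>v\<in>?C. (real (k v) / real p) *\<^sub>R v)"
      unfolding sum_C ka by (simp add: A_def k algebra_simps)
    moreover have "sum k ?C = p"
      using ij by (simp add: sum_C k)
    ultimately have "A (vector [real i, real j]) \<in> nodes p T"
      unfolding nodes_def by blast
    then show "h (vector [real i, real j]) = 0"
      by (simp add: h_def eq)
  qed
  \<comment> \<open>Surjectivity of \<open>A\<close>: a preimage of \<open>x\<close> consists of its
    barycentric coordinates scaled by \<open>p\<close>.\<close>
  moreover have "A (vector [p * L b x, p * L c x]) = x"
  proof -
    have "L a x = 1 - L b x - L c x"
      using L_sum[of x] by (simp add: sum_C)
    then have "(1 - L b x - L c x) *\<^sub>R a + L b x *\<^sub>R b + L c x *\<^sub>R c = x"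
      using L_comb[of x] by (simp add: sum_C)
    moreover have "A (vector [p * L b x, p * L c x])
        = (1 - L b x - L c x) *\<^sub>R a + L b x *\<^sub>R b + L c x *\<^sub>R c"
      using assms(2) by (simp add: A_def algebra_simps)
    ultimately show ?thesis by simp
  qed
  ultimately show "f x = g x"
    unfolding h_def by (metis add.commute add_diff_cancel_left' diff_0 mult_minus1 neg_equal_iff_equal
        diff_add_cancel)
qed

lemma shape_fun:
  assumes "2 simplex T" "0 < p" "a \<in> nodes p T"
  shows shape_fun_in_poly_space: "shape_fun p T a \<in> poly_space p"
    and shape_fun_node: "b \<in> nodes p T \<Longrightarrow> shape_fun p T a b = (if b = a then 1 else 0)"
proof -
  let ?P = "\<lambda>f. f \<in> poly_space p \<and> (\<forall>b\<in>nodes p T. f b = (if b = a then 1 else 0))"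
  have "\<exists>!f. ?P f"
    using Lagrange_existence[OF assms]
    by (intro ex_ex1I) (auto intro: Lagrange_uniqueness[OF assms(1,2)])
  then have "?P (shape_fun p T a)"
    unfolding shape_fun_def by (rule theI')
  then show "shape_fun p T a \<in> poly_space p"
    and "b \<in> nodes p T \<Longrightarrow> shape_fun p T a b = (if b = a then 1 else 0)"
    by auto
qed

text \<open>Two polynomials of degree at most \<open>p\<close> that both take the value 1 at every
  node.\<close>

lemma sum_shape_fun:
  assumes "2 simplex T" "0 < p"
  shows "(\<lambda>x. \<Sum>a\<in>nodes p T. shape_fun p T a x) = (\<lambda>_. 1)"
proof (rule Lagrange_uniqueness[OF assms])
  have "finite (vertices T)"
    using assms(1) by (auto elim!: triangleE simp: card_ge_0_finite)
  then have "finite (nodes p T)" by (rule finite_nodes)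
  then show "(\<Sum>a\<in>nodes p T. shape_fun p T a b) = 1" if "b \<in> nodes p T" for b
    using that assms by (simp add: shape_fun_node)
  show "(\<lambda>x. \<Sum>a\<in>nodes p T. shape_fun p T a x) \<in> poly_space p"
    using assms by (intro poly_space_sum shape_fun_in_poly_space)
qed (rule poly_space_const)

section \<open>Partial derivatives\<close>

lemma pd_const [simp]: "pd i (\<lambda>_. c) = (\<lambda>_. 0)"
  by (simp add: pd_def fun_eq_iff)

lemma pd_eqI: "(f has_derivative f') (at x) \<Longrightarrow> pd i f x = f' (axis i 1)"
  unfolding pd_def by (metis frechet_derivative_at)

text \<open>\<open>frechet_derivative\<close> is a choice operator, meaningful at points of
  differentiability; membership in \<open>poly_space\<close> guarantees these.\<close>

lemma pd_add:
  assumes "f \<in> poly_space p" "g \<in> poly_space p"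
  shows "pd i (\<lambda>x. f x + g x) = (\<lambda>x. pd i f x + pd i g x)"
proof
  fix x
  have "(f has_derivative frechet_derivative f (at x)) (at x)"
    and "(g has_derivative frechet_derivative g (at x)) (at x)"
    using assms[THEN poly_space_differentiable] frechet_derivative_works by blast+
  then show "pd i (\<lambda>x. f x + g x) x = pd i f x + pd i g x"
    by (simp add: pd_eqI[OF has_derivative_add]) (simp add: pd_def)
qed

lemma pd_cmult:
  assumes "f \<in> poly_space p"
  shows "pd i (\<lambda>x. c * f x) = (\<lambda>x. c * pd i f x)"
proof
  fix x
  have "(f has_derivative frechet_derivative f (at x)) (at x)"
    using poly_space_differentiable[OF assms] frechet_derivative_works by blast
  then have "((\<lambda>x. c * f x) has_derivative (\<lambda>h. c * frechet_derivative f (at x) h)) (at x)"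
    by (rule has_derivative_mult_right)
  then show "pd i (\<lambda>x. c * f x) x = c * pd i f x"
    by (simp add: pd_eqI) (simp add: pd_def)
qed

text \<open>The degree bound is deliberately not lowered: iterated derivatives then stay in one
  space, ready for the next use of \<open>pd_sum\<close>.\<close>

lemma pd_in_poly_space:
  assumes "f \<in> poly_space p"
  shows "pd k f \<in> poly_space p"
  using assms
proof (induction rule: poly_space_induct)
  case (monomial i j)
  have "((\<lambda>x::plane. (x $ 1) ^ i * (x $ 2) ^ j) has_derivative
      (\<lambda>h. (x $ 1) ^ i * (of_nat j * h $ 2 * (x $ 2) ^ (j - 1)) 
          + of_nat i * h $ 1 * (x $ 1) ^ (i - 1) * (x $ 2) ^ j)) (at x)" for x
    by (intro has_derivative_mult has_derivative_power 
        bounded_linear_imp_has_derivative bounded_linear_vec_nth)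
  from pd_eqI[OF this]
  \<comment> \<open>For \<open>i = 0\<close> or \<open>j = 0\<close> truncated subtraction leaves
    the exponent 0, while the coefficient of that term is 0.\<close>
  have "pd k (\<lambda>x. (x $ 1) ^ i * (x $ 2) ^ j) =
      (\<lambda>x. (of_nat j * axis k 1 $ 2) * ((x $ 1) ^ i * (x $ 2) ^ (j - 1))
         + (of_nat i * axis k 1 $ 1) * ((x $ 1) ^ (i - 1) * (x $ 2) ^ j))"
    by (auto simp: fun_eq_iff algebra_simps)
  also have "\<dots> \<in> poly_space p"
    using monomial
    by (intro poly_space_add poly_space_cmult monomial_in_poly_space) auto
  finally show ?case .
qed (auto simp: pd_add pd_cmult)

lemma pd_sum:
  assumes "\<And>a. a \<in> A \<Longrightarrow> f a \<in> poly_space p"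
  shows "pd i (\<lambda>x. \<Sum>a\<in>A. f a x) = (\<lambda>x. \<Sum>a\<in>A. pd i (f a) x)"
  using assms
proof (induction A rule: infinite_finite_induct)
  case (insert a A)
  then show ?case
    by (simp add: pd_add[of _ p] poly_space_sum)
qed auto

lemma laplacian_in_poly_space: "f \<in> poly_space p \<Longrightarrow> laplacian f \<in> poly_space p"
  unfolding laplacian_def by (intro poly_space_sum pd_in_poly_space)

lemma laplacian_const [simp]: "laplacian (\<lambda>_. c) = (\<lambda>_. 0)"
  by (simp add: laplacian_def fun_eq_iff)

lemma d_n_const [simp]: "d_n n (\<lambda>_. c) x = 0"
  and d_nn_const [simp]: "d_nn n (\<lambda>_. c) x = 0"
  and d_ntt_const [simp]: "d_ntt n t (\<lambda>_. c) x = 0"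
  by (simp_all add: d_n_def d_nn_def d_ntt_def)

context
  fixes A :: "'i set" and f :: "'i \<Rightarrow> plane \<Rightarrow> real" and p :: nat
  assumes f: "\<And>a. a \<in> A \<Longrightarrow> f a \<in> poly_space p"
begin

text \<open>Writing out the two coordinates with \<open>sum_2\<close> avoids exchanging the order of
  summation.\<close>

lemma laplacian_sum: "laplacian (\<lambda>x. \<Sum>a\<in>A. f a x) = (\<lambda>x. \<Sum>a\<in>A. laplacian (f a) x)"
  by (simp add: fun_eq_iff laplacian_def sum_2 sum.distrib pd_sum[of _ _ p] f pd_in_poly_space)

lemma d_n_sum: "d_n n (\<lambda>x. \<Sum>a\<in>A. f a x) y = (\<Sum>a\<in>A. d_n n (f a) y)"
  by (simp add: d_n_def sum_2 sum.distrib sum_distrib_left pd_sum[of _ _ p] f)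

lemma d_nn_sum: "d_nn n (\<lambda>x. \<Sum>a\<in>A. f a x) y = (\<Sum>a\<in>A. d_nn n (f a) y)"
  by (simp add: d_nn_def sum_2 sum.distrib sum_distrib_left pd_sum[of _ _ p] f pd_in_poly_space)

lemma d_ntt_sum: "d_ntt n t (\<lambda>x. \<Sum>a\<in>A. f a x) y = (\<Sum>a\<in>A. d_ntt n t (f a) y)"
  by (simp add: d_ntt_def sum_2 sum.distrib sum_distrib_left pd_sum[of _ _ p] f pd_in_poly_space)

end

section \<open>Linearity of the bilinear form\<close>

definition sum_pair :: "('i \<Rightarrow> fpair) \<Rightarrow> 'i set \<Rightarrow> fpair" where
  "sum_pair u A = (\<lambda>x. \<Sum>a\<in>A. fst (u a) x, \<lambda>x. \<Sum>a\<in>A. snd (u a) x)"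

lemma sum_pair_simps [simp]:
  "fst (sum_pair u A) = (\<lambda>x. \<Sum>a\<in>A. fst (u a) x)"
  "snd (sum_pair u A) = (\<lambda>x. \<Sum>a\<in>A. snd (u a) x)"
  by (simp_all add: sum_pair_def)

lemma jump0_sum: "jump0 \<gamma> (sum_pair u A) s = (\<Sum>a\<in>A. jump0 \<gamma> (u a) s)"
  by (simp add: jump0_def sum_subtractf)

context
  fixes A :: "'i set" and u :: "'i \<Rightarrow> fpair" and p :: nat
  assumes u: "\<And>a. a \<in> A \<Longrightarrow> u a \<in> poly_space p \<times> poly_space p"
begin

private lemma u_components:
  "a \<in> A \<Longrightarrow> fst (u a) \<in> poly_space p" "a \<in> A \<Longrightarrow> snd (u a) \<in> poly_space p"
  using u by (auto simp: mem_Times_iff)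

lemma jump1_sum: "jump1 \<gamma> (sum_pair u A) s = (\<Sum>a\<in>A. jump1 \<gamma> (u a) s)"
  by (simp add: jump1_def sum_subtractf d_n_sum[of _ _ p] u_components)

lemma jump2_sum: "jump2 \<gamma> \<beta>p \<beta>m (sum_pair u A) s = (\<Sum>a\<in>A. jump2 \<gamma> \<beta>p \<beta>m (u a) s)"
  by (simp add: jump2_def sum_subtractf sum_distrib_left d_nn_sum[of _ _ p] u_components)

lemma jump3_sum: "jump3 \<gamma> \<beta>p \<beta>m (sum_pair u A) s = (\<Sum>a\<in>A. jump3 \<gamma> \<beta>p \<beta>m (u a) s)"
  by (simp add: jump3_def sum_subtractf sum_distrib_left distrib_left sum.distrib
      laplacian_sum[of _ _ p] laplacian_in_poly_space d_n_sum[of _ _ p] d_ntt_sum[of _ _ p]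
      u_components)

end

section \<open>Continuity of the jumps and additivity of the curve integral\<close>

lemma poly_space_continuous_on_curve:
  assumes "f \<in> poly_space p" "continuous_on S \<gamma>"
  shows "continuous_on S (\<lambda>s. f (\<gamma> s))"
  using poly_space_continuous_on[OF assms(1)] assms(2) by (rule continuous_on_compose2) auto

lemma continuous_on_d_n:
  assumes "f \<in> poly_space p" "continuous_on S \<gamma>" "continuous_on S n"
  shows "continuous_on S (\<lambda>s. d_n (n s) f (\<gamma> s))"
  unfolding d_n_def
  by (intro continuous_intros poly_space_continuous_on_curve[of _ p] pd_in_poly_space assms)

lemma continuous_on_d_nn:
  assumes "f \<in> poly_space p" "continuous_on S \<gamma>" "continuous_on S n"
  shows "continuous_on S (\<lambda>s. d_nn (n s) f (\<gamma> s))"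
  unfolding d_nn_def
  by (intro continuous_intros poly_space_continuous_on_curve[of _ p] pd_in_poly_space assms)

lemma continuous_on_d_ntt:
  assumes "f \<in> poly_space p" "continuous_on S \<gamma>" "continuous_on S n" "continuous_on S t"
  shows "continuous_on S (\<lambda>s. d_ntt (n s) (t s) f (\<gamma> s))"
  unfolding d_ntt_def
  by (intro continuous_intros poly_space_continuous_on_curve[of _ p] pd_in_poly_space assms)

text \<open>Regularity of the curve enters through the unit tangent: \<open>sgn\<close> is
  continuous away from 0, and the derivative never vanishes.\<close>

lemma
  assumes "regular_simple_closed_C2 \<gamma>"
  shows C2_curve_continuous_on: "continuous_on S \<gamma>"
    and C2_curve_derivative_continuous_on: "continuous_on S (\<lambda>s. vector_derivative \<gamma> (at s))"
    and C2_curve_tangent_continuous_on: "continuous_on S (tangent \<gamma>)"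
    and C2_curve_normal_continuous_on: "continuous_on S (normal \<gamma>)"
proof -
  obtain \<gamma>1 \<gamma>2 where \<gamma>: "\<And>s. (\<gamma> has_vector_derivative \<gamma>1 s) (at s)"
    "\<And>s. (\<gamma>1 has_vector_derivative \<gamma>2 s) (at s)" and nz: "\<And>s. \<gamma>1 s \<noteq> 0"
    using assms by (auto simp: regular_simple_closed_C2_def)
  have eq: "vector_derivative \<gamma> (at s) = \<gamma>1 s" for s
    using \<gamma>(1) by (rule vector_derivative_at)
  show "continuous_on S \<gamma>"
    using \<gamma>(1) by (meson continuous_at_imp_continuous_on has_vector_derivative_continuous)
  have \<gamma>1: "continuous_on S \<gamma>1"
    using \<gamma>(2) by (meson continuous_at_imp_continuous_on has_vector_derivative_continuous)
  then show "continuous_on S (\<lambda>s. vector_derivative \<gamma> (at s))"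
    by (simp add: eq)
  have "tangent \<gamma> = (\<lambda>s. sgn (\<gamma>1 s))"
    by (simp add: tangent_def eq fun_eq_iff)
  then show tan: "continuous_on S (tangent \<gamma>)"
    using \<gamma>1 nz by (simp add: continuous_on_sgn)
  \<comment> \<open>The normal is rewritten as a vector abstraction so that continuity can be
    checked componentwise.\<close>
  have "continuous_on S (\<lambda>s. (\<chi> i. if i = 1 then tangent \<gamma> s $ 2 else - tangent \<gamma> s $ 1) :: plane)"
  proof (intro continuous_on_vec_lambda)
    fix i :: 2
    show "continuous_on S (\<lambda>s. if i = 1 then tangent \<gamma> s $ 2 else - tangent \<gamma> s $ 1)"
      by (cases "i = 1") (auto intro!: continuous_on_minus continuous_on_component tan)
  qed
  moreover have "normal \<gamma> = (\<lambda>s. \<chi> i. if i = 1 then tangent \<gamma> s $ 2 else - tangent \<gamma> s $ 1)"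
    by (simp add: normal_def fun_eq_iff vec_eq_iff forall_2)
  ultimately show "continuous_on S (normal \<gamma>)" by simp
qed

lemma continuous_on_jumps:
  assumes \<gamma>: "regular_simple_closed_C2 \<gamma>" and u: "u \<in> poly_space p \<times> poly_space p"
  shows "continuous_on S (jump0 \<gamma> u)" "continuous_on S (jump1 \<gamma> u)"
    "continuous_on S (jump2 \<gamma> \<beta>p \<beta>m u)" "continuous_on S (jump3 \<gamma> \<beta>p \<beta>m u)"
proof -
  have u': "fst u \<in> poly_space p" "snd u \<in> poly_space p"
    using u by (auto simp: mem_Times_iff)
  note cont = C2_curve_continuous_on[OF \<gamma>] C2_curve_normal_continuous_on[OF \<gamma>]
    C2_curve_tangent_continuous_on[OF \<gamma>]
  show "continuous_on S (jump0 \<gamma> u)"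
    unfolding jump0_def[abs_def] by (intro continuous_on_diff poly_space_continuous_on_curve[of _ p] u' cont)
  show "continuous_on S (jump1 \<gamma> u)"
    unfolding jump1_def[abs_def]
    by (intro continuous_on_diff continuous_on_d_n[of _ p] u' cont)
  show "continuous_on S (jump2 \<gamma> \<beta>p \<beta>m u)"
    unfolding jump2_def[abs_def]
    by (intro continuous_on_diff continuous_on_mult_left continuous_on_d_nn[of _ p] u' cont)
  show "continuous_on S (jump3 \<gamma> \<beta>p \<beta>m u)"
    unfolding jump3_def[abs_def] Let_def
    by (intro continuous_on_diff continuous_on_add continuous_on_mult_left continuous_on_d_n[of _ p]
        continuous_on_d_ntt[of _ p] laplacian_in_poly_space u' cont)
qed

text \<open>The image of a compact set under a homothety. Closedness makes the parameter set of the
  curve integral measurable.\<close>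

lemma closed_fictitious_element:
  assumes "compact T"
  shows "closed (fictitious_element lam T)"
proof -
  define B where "B = (1 / 3) *\<^sub>R (\<Sum>v\<in>vertices T. v)"
  have "fictitious_element lam T = (\<lambda>Y. B + lam *\<^sub>R (Y - B)) ` T"
    by (auto simp: fictitious_element_def Let_def B_def[symmetric] image_iff algebra_simps)
  also have "compact \<dots>"
    by (intro compact_continuous_image continuous_intros assms)
  finally show ?thesis by (rule compact_imp_closed)
qed

text \<open>The integral of a non-integrable function is 0 by default, so every summand must be
  shown integrable. Continuity gives this on \<open>{0..1}\<close>, and it passes to the closed set
  of parameters mapped into \<open>X\<close>.\<close>

lemma curve_integral_sum:
  assumes "regular_simple_closed_C2 \<gamma>" "closed X"
    and f: "\<And>a. a \<in> A \<Longrightarrow> continuous_on {0..1} (f a)"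
  shows "curve_integral \<gamma> X (\<lambda>s. \<Sum>a\<in>A. f a s) = (\<Sum>a\<in>A. curve_integral \<gamma> X (f a))"
proof -
  let ?S = "{s \<in> {0..1}. \<gamma> s \<in> X}" and ?g = "\<lambda>a s. f a s * norm (vector_derivative \<gamma> (at s))"
  have "?S = {0..1} \<inter> \<gamma> -` X" by auto
  then have "closed ?S"
    using continuous_closed_preimage[OF C2_curve_continuous_on[OF assms(1)] closed_atLeastAtMost assms(2)]
    by simp
  then have S: "?S \<in> sets lborel" by simp
  have int: "set_integrable lborel ?S (?g a)" if "a \<in> A" for a
  proof (rule set_integrable_subset[OF _ S])
    show "set_integrable lborel {0..1} (?g a)"
      using that
      by (intro borel_integrable_atLeastAtMost' continuous_intros f
          C2_curve_derivative_continuous_on[OF assms(1)])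
  qed auto
  show ?thesis
    unfolding curve_integral_def set_lebesgue_integral_def sum_distrib_right scaleR_sum_right
    by (rule Bochner_Integration.integral_sum) (rule int[unfolded set_integrable_def])
qed

lemma J_form_sum:
  assumes \<gamma>: "regular_simple_closed_C2 \<gamma>" and "compact T"
    and u: "\<And>a. a \<in> A \<Longrightarrow> u a \<in> poly_space p \<times> poly_space p"
    and w: "w \<in> poly_space p \<times> poly_space p"
  shows "J_form \<gamma> \<beta>p \<beta>m \<omega> lam h T (sum_pair u A) w
    = (\<Sum>a\<in>A. J_form \<gamma> \<beta>p \<beta>m \<omega> lam h T (u a) w)"
proof -
  \<comment> \<open>One statement for all four terms of the form, with \<open>j\<close> standing for
    any of the jump operators.\<close>
  have *: "curve_integral \<gamma> (fictitious_element lam T) (\<lambda>s. (\<Sum>a\<in>A. j (u a) s) * j w s)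
      = (\<Sum>a\<in>A. curve_integral \<gamma> (fictitious_element lam T) (\<lambda>s. j (u a) s * j w s))"
    if "\<And>u. u \<in> poly_space p \<times> poly_space p \<Longrightarrow> continuous_on {0..1} (j u)" for j
    unfolding sum_distrib_right
    by (intro curve_integral_sum \<gamma> closed_fictitious_element \<open>compact T\<close> continuous_on_mult that u w)
  show ?thesis
    using continuous_on_jumps[OF \<gamma>]
    by (simp add: J_form_def Let_def jump0_sum jump1_sum[OF u] jump2_sum[OF u] jump3_sum[OF u]
        * sum.distrib sum_distrib_left)
qed

lemma J_form_const_eq_0: "J_form \<gamma> \<beta>p \<beta>m \<omega> lam h T (\<lambda>_. c, \<lambda>_. c) w = 0"
  by (simp add: J_form_def Let_def jump0_def jump1_def jump2_def jump3_def curve_integral_def)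

section \<open>Partition of unity\<close>

lemma xi_eta_in_poly_space:
  assumes "2 simplex T" "0 < p" "a \<in> nodes p T"
  shows xi_basis_in_poly_space: "xi_basis p T Tp a \<in> poly_space p \<times> poly_space p"
    and eta_basis_in_poly_space: "eta_basis p T Tp a \<in> poly_space p \<times> poly_space p"
  using shape_fun_in_poly_space[OF assms] by (auto simp: xi_basis_def eta_basis_def)

lemma xi_eta_comb_in_poly_space:
  assumes "2 simplex T" "0 < p"
  shows "xi_eta_comb p T Tp v c \<in> poly_space p \<times> poly_space p"
  using xi_eta_in_poly_space[OF assms, of _ Tp]
  by (auto simp: xi_eta_comb_def mem_Times_iff intro!: poly_space_sum poly_space_add poly_space_cmult)

text \<open>Joint linearity in both coefficient vectors; it supplies the eta coefficients that
  \<open>is_ife_pair\<close> demands of a sum.\<close>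

lemma xi_eta_comb_sum:
  "sum_pair (\<lambda>i. xi_eta_comb p T Tp (v i) (c i)) A =
    xi_eta_comb p T Tp (\<lambda>b. \<Sum>i\<in>A. v i b) (\<lambda>b. \<Sum>i\<in>A. c i b)"
  by (simp add: sum_pair_def xi_eta_comb_def sum_distrib_right sum.distrib sum.swap[of _ A])

text \<open>Allows nodal value vectors to differ off the nodes, where the canonical basis vectors
  sum to 0 instead of 1.\<close>

lemma xi_eta_comb_cong:
  "(\<And>a. a \<in> nodes p T \<Longrightarrow> v a = v' a) \<Longrightarrow> xi_eta_comb p T Tp v c = xi_eta_comb p T Tp v' c"
  by (simp add: xi_eta_comb_def)

lemma is_ife_pair_const_1:
  assumes "2 simplex T" "0 < p"
  shows "is_ife_pair (J_form \<gamma> \<beta>p \<beta>m \<omega> lam h T) p T Tp (\<lambda>_. 1) (\<lambda>_. 1, \<lambda>_. 1)"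
proof -
  \<comment> \<open>Whichever side a node is assigned to, its xi and eta pairs add up to its shape
    function in both components.\<close>
  have "fst (xi_basis p T Tp a) x + fst (eta_basis p T Tp a) x = shape_fun p T a x"
    and "snd (xi_basis p T Tp a) x + snd (eta_basis p T Tp a) x = shape_fun p T a x" for a x
    by (simp_all add: xi_basis_def eta_basis_def)
  then have "xi_eta_comb p T Tp (\<lambda>_. 1) (\<lambda>_. 1) = (\<lambda>_. 1, \<lambda>_. 1)"
    by (simp add: xi_eta_comb_def sum_shape_fun[OF assms])
  then show ?thesis
    unfolding is_ife_pair_def by (metis J_form_const_eq_0)
qed

lemma is_ife_pair_sum:
  assumes "regular_simple_closed_C2 \<gamma>" "2 simplex T" "0 < p"
    and J: "J = J_form \<gamma> \<beta>p \<beta>m \<omega> lam h T"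
    and \<phi>: "\<And>i. i \<in> A \<Longrightarrow> is_ife_pair J p T Tp (v i) (\<phi> i)"
  shows "is_ife_pair J p T Tp (\<lambda>b. \<Sum>i\<in>A. v i b) (sum_pair \<phi> A)"
proof -
  obtain c where c: "\<And>i. i \<in> A \<Longrightarrow> \<phi> i = xi_eta_comb p T Tp (v i) (c i)"
    using \<phi> unfolding is_ife_pair_def by metis
  then have "sum_pair \<phi> A = sum_pair (\<lambda>i. xi_eta_comb p T Tp (v i) (c i)) A"
    by (simp add: sum_pair_def)
  moreover have "compact T"
    using assms(2) by (metis triangleE compact_convex_hull finite_imp_compact aff_independent_finite)
  then have "J (sum_pair \<phi> A) (eta_basis p T Tp b) = (\<Sum>i\<in>A. J (\<phi> i) (eta_basis p T Tp b))"
    if "b \<in> nodes p T" for b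
    unfolding J
    using assms(1-3) that c
    by (intro J_form_sum[of _ _ _ _ p]) (auto simp only: xi_eta_comb_in_poly_space eta_basis_in_poly_space)
  ultimately show ?thesis
    using \<phi> by (auto simp: is_ife_pair_def xi_eta_comb_sum)
qed

lemma is_ife_pair_ife_pair:
  "ife_unisolvent J p T Tp \<Longrightarrow> is_ife_pair J p T Tp v (ife_pair J p T Tp v)"
  unfolding ife_unisolvent_def ife_pair_def by (blast intro: theI')

lemma sum_ife_basis_eq_1:
  assumes "regular_simple_closed_C2 \<gamma>" "2 simplex T" "0 < p"
    and J: "J = J_form \<gamma> \<beta>p \<beta>m \<omega> lam h T" and uni: "ife_unisolvent J p T Tp"
  shows "(\<Sum>a\<in>nodes p T. ife_basis J p T Tp a x) = 1"
proof -
  define e :: "plane \<Rightarrow> plane \<Rightarrow> real" where "e = (\<lambda>a b. if b = a then 1 else 0)"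
  let ?N = "nodes p T" and ?\<phi> = "\<lambda>a. ife_pair J p T Tp (e a)"
  have "finite (vertices T)"
    using assms(2) by (auto elim!: triangleE simp: card_ge_0_finite)
  then have "(\<Sum>a\<in>?N. e a b) = 1" if "b \<in> ?N" for b
    using that by (simp add: e_def finite_nodes)
  then have "xi_eta_comb p T Tp (\<lambda>b. \<Sum>a\<in>?N. e a b) = xi_eta_comb p T Tp (\<lambda>_. 1)"
    by (intro ext xi_eta_comb_cong)
  moreover have "is_ife_pair J p T Tp (\<lambda>b. \<Sum>a\<in>?N. e a b) (sum_pair ?\<phi> ?N)"
    using assms by (intro is_ife_pair_sum is_ife_pair_ife_pair)
  ultimately have "is_ife_pair J p T Tp (\<lambda>_. 1) (sum_pair ?\<phi> ?N)"
    by (simp add: is_ife_pair_def)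
  moreover have "is_ife_pair J p T Tp (\<lambda>_. 1) (\<lambda>_. 1, \<lambda>_. 1)"
    unfolding J by (rule is_ife_pair_const_1[OF assms(2,3)])
  ultimately have "sum_pair ?\<phi> ?N = (\<lambda>_. 1, \<lambda>_. 1)"
    using uni unfolding ife_unisolvent_def by blast
  then have "glue Tp (sum_pair ?\<phi> ?N) x = 1"
    by (simp add: glue_def)
  \<comment> \<open>Gluing selects one component at each point, by a test independent of
    \<open>a\<close>, so it commutes with the sum.\<close>
  moreover have "(\<Sum>a\<in>?N. ife_basis J p T Tp a x) = glue Tp (sum_pair ?\<phi> ?N) x"
    by (simp add: ife_basis_def glue_def e_def)
  ultimately show ?thesis by simp
qed

theorem theorem3p3:
  fixes \<Omega> \<Omega>p \<Omega>m \<Gamma> Q T Tp :: "plane set"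
    and \<gamma> :: "real \<Rightarrow> plane"
    and \<T> :: "plane set set"
    and \<beta>p \<beta>m \<sigma> r lam :: real
    and \<omega> :: "nat \<Rightarrow> real"
    and p :: nat
    and J :: "fpair \<Rightarrow> fpair \<Rightarrow> real"
  assumes "polygonal_domain \<Omega>"
    and "regular_simple_closed_C2 \<gamma>" and "\<Gamma> = path_image \<gamma>"
    and "separates_into \<Gamma> \<Omega> \<Omega>p \<Omega>m"
    and "\<beta>p > 0" and "\<beta>m > 0"
    and "triangular_mesh \<Omega> \<T>" and "shape_regular \<sigma> \<T>"
    and "edge_condition \<Gamma> \<T>" and "element_condition \<Gamma> \<T>"
    and "r > 0" and "disjoint_normal_segments \<gamma> r" and "mesh_size \<T> < r / 2"
    and "lam > 1"
    and "\<forall>k\<in>{0..3}. \<omega> k > 0"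
    and "p \<in> {2, 3}"
    and "T \<in> interface_elements \<Gamma> \<T>"
    and "Tp = plus_part \<Gamma> \<Omega>p Q T"
    and "J = J_form \<gamma> \<beta>p \<beta>m \<omega> lam (mesh_size \<T>) T"
    and "ife_unisolvent J p T Tp"
  shows "\<forall>x\<in>T. (\<Sum>a\<in>nodes p T. ife_basis J p T Tp a x) = 1"
proof
  fix x assume "x \<in> T"
  have "2 simplex T"
    using assms(7,17) by (simp add: triangular_mesh_def interface_elements_def)
  moreover have "0 < p"
    using assms(16) by auto
  ultimately show "(\<Sum>a\<in>nodes p T. ife_basis J p T Tp a x) = 1"
    using assms(2,19,20) by (intro sum_ife_basis_eq_1)
qed

end
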